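(* Let $E$ and $F$ be Banach spaces such that $F$ has an unconditional finite dimensional decomposition with unconditional constant equal to $1$ and associated projections $\{\pi_m\}_m$, and let $\pi^m=Id-\pi_m$. Let $n\ge1$ and suppose that there exist polynomials $P\in\mathcal P(^nE,F)$ and $Q\in\mathcal P_w(^nE,F)$ and numbers $\delta>0$ and $m_0\in\mathbb N$ such that: (1) $0<\|Q\|\le\|P\|<\delta$; (2) $\|\pi^mP+Q\|\ge\delta$ for all $m\ge m_0$. Then $\mathcal P_w(^nE,F)$ is not a semi $M$-ideal in $\mathcal P(^nE,F)$.
   Context: $\mathcal P(^nE,F)$ is the Banach space of continuous $n$-homogeneous polynomials $P:E\to F$ with norm $\|P\|=\sup_{\|x\|\le1}\|P(x)\|$. $\mathcal P_w(^nE,F)$ is the subspace of polynomials that are weakly continuous on bounded sets: $\|P(x_\alpha)-P(x)\|\to0$ for every bounded net $(x_\alpha)$ converging weakly to $x\in E$. A finite dimensional decomposition of $F$ is a sequence $\{F_j\}_j$ of finite dimensional subspaces such that every $y\in F$ is uniquely $y=\sum_{j=1}^\infty y_j$ with $y_j\in F_j$; its projections are $\pi_m(y)=\sum_{j=1}^m y_j$. It is unconditional if these expansions converge unconditionally; unconditional constant $1$ means that $\|\sum_j\theta_jy_j\|\le\|\sum_jy_j\|$ for all $y=\sum_j y_j\in F$ and all scalars with $|\theta_j|\le1$. A closed subspace $J$ of $X$ is a semi $M$-ideal if it satisfies the 2-ball property: for all $x_1,x_2\in X$ and $r_1,r_2>0$ with $B(x_1,r_1)\cap B(x_2,r_2)\ne\emptyset$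 and $B(x_j,r_j)\cap J\neq\emptyset$ ($j=1,2$), one has $B(x_1,r_1+\varepsilon)\cap B(x_2,r_2+\varepsilon)\cap J\neq\emptyset$ for all $\varepsilon>0$, where $B(x,r)$ is the closed ball. *)

theory Defs
  imports "HOL-Analysis.Analysis" "HOL-Library.Function_Algebras"
begin

text \<open>
  Scalars. The scalar field is a type \<open>'k\<close> of class \<open>real_normed_field\<close> and \<open>heine_borel\<close>; by the
  Gelfand--Mazur theorem these are, up to isometric isomorphism, exactly the real and the complex
  numbers, so both cases are treated at once. A Banach space over \<open>'k\<close> is a type of class
  \<open>banach\<close> with a scalar multiplication by \<open>'k\<close> for which the norm is homogeneous.
\<close>

locale normed_space_over = vector_space scale
  for scale :: "'k::real_normed_field \<Rightarrow> 'a::real_normed_vector \<Rightarrow> 'a" +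
  assumes norm_scale: "norm (scale c x) = norm c * norm x"
    and scale_of_real: "scale (of_real r) x = r *\<^sub>R x"

lemma normed_space_over_scaleR:
  "normed_space_over (scaleR :: real \<Rightarrow> 'a::real_normed_vector \<Rightarrow> 'a)"
  by unfold_locales (auto simp: scaleR_add_right scaleR_add_left)

lemma normed_space_over_complex:
  "normed_space_over ((*) :: complex \<Rightarrow> complex \<Rightarrow> complex)"
  by unfold_locales (auto simp: algebra_simps norm_mult scaleR_conv_of_real)


subsection \<open>Homogeneous polynomials\<close>

text \<open>
  An \<open>n\<close>-tuple is represented by a function on \<open>nat\<close> of which only the values at \<open>i < n\<close> matter;
  the first conjunct ensures that \<open>A\<close> does not look at the other values.
\<close>

definition multilinear_on ::
  "('k::field \<Rightarrow> 'a::ab_group_add \<Rightarrow> 'a) \<Rightarrow> ('k \<Rightarrow> 'b::ab_group_add \<Rightarrow> 'b) \<Rightarrow> nat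
    \<Rightarrow> ((nat \<Rightarrow> 'a) \<Rightarrow> 'b) \<Rightarrow> bool" where
  "multilinear_on sE sF n A \<longleftrightarrow>
     (\<forall>v w. (\<forall>i<n. v i = w i) \<longrightarrow> A v = A w) \<and>
     (\<forall>v. \<forall>i<n. Vector_Spaces.linear sE sF (\<lambda>x. A (v(i := x))))"

definition hom_poly ::
  "('k::field \<Rightarrow> 'a::real_normed_vector \<Rightarrow> 'a) \<Rightarrow> ('k \<Rightarrow> 'b::real_normed_vector \<Rightarrow> 'b) \<Rightarrow> nat
    \<Rightarrow> ('a \<Rightarrow> 'b) set" where
  "hom_poly sE sF n =
     {P. continuous_on UNIV P \<and> (\<exists>A. multilinear_on sE sF n A \<and> (\<forall>x. P x = A (\<lambda>_. x)))}"

definition poly_norm :: "('a::real_normed_vector \<Rightarrow> 'b::real_normed_vector) \<Rightarrow> real" where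
  "poly_norm P = (SUP x\<in>cball 0 1. norm (P x))"

definition dual_space :: "('k::real_normed_field \<Rightarrow> 'a::real_normed_vector \<Rightarrow> 'a) \<Rightarrow> ('a \<Rightarrow> 'k) set" where
  "dual_space sE = {\<phi>. Vector_Spaces.linear sE (*) \<phi> \<and> continuous_on UNIV \<phi>}"

definition weakly_converges ::
  "('k::real_normed_field \<Rightarrow> 'a::real_normed_vector \<Rightarrow> 'a) \<Rightarrow> 'a \<Rightarrow> 'a filter \<Rightarrow> bool" where
  "weakly_converges sE x G \<longleftrightarrow> (\<forall>\<phi>\<in>dual_space sE. (\<phi> \<longlongrightarrow> \<phi> x) G)"

text \<open>
  A net in \<open>E\<close> is represented by the filter generated by its tails (its image filter), which
  determines all its limits; every filter arises in this way.
\<close>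

definition weakly_continuous_on_bounded ::
  "('k::real_normed_field \<Rightarrow> 'a::real_normed_vector \<Rightarrow> 'a) \<Rightarrow> ('a \<Rightarrow> 'b::real_normed_vector) \<Rightarrow> bool" where
  "weakly_continuous_on_bounded sE P \<longleftrightarrow>
     (\<forall>G x B. bounded B \<and> (\<forall>\<^sub>F y in G. y \<in> B) \<and> weakly_converges sE x G
        \<longrightarrow> ((\<lambda>y. norm (P y - P x)) \<longlongrightarrow> 0) G)"

definition hom_poly_w ::
  "('k::real_normed_field \<Rightarrow> 'a::real_normed_vector \<Rightarrow> 'a) \<Rightarrow> ('k \<Rightarrow> 'b::real_normed_vector \<Rightarrow> 'b) \<Rightarrow> nat
    \<Rightarrow> ('a \<Rightarrow> 'b) set" where
  "hom_poly_w sE sF n = {P \<in> hom_poly sE sF n. weakly_continuous_on_bounded sE P}"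

definition fun_scale :: "('k \<Rightarrow> 'b \<Rightarrow> 'b) \<Rightarrow> 'k \<Rightarrow> ('a \<Rightarrow> 'b) \<Rightarrow> 'a \<Rightarrow> 'b" where
  "fun_scale sF c P = (\<lambda>x. sF c (P x))"


subsection \<open>Finite dimensional decompositions\<close>

text \<open>The summands are indexed from \<open>0\<close>, so \<open>\<pi>\<^sub>m y\<close> is the sum of the components with index \<open>j < m\<close>.\<close>

definition is_expansion :: "(nat \<Rightarrow> 'b::real_normed_vector set) \<Rightarrow> 'b \<Rightarrow> (nat \<Rightarrow> 'b) \<Rightarrow> bool" where
  "is_expansion V y v \<longleftrightarrow> (\<forall>j. v j \<in> V j) \<and> v sums y"

definition fdd ::
  "('k::field \<Rightarrow> 'b::real_normed_vector \<Rightarrow> 'b) \<Rightarrow> (nat \<Rightarrow> 'b set) \<Rightarrow> bool" where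
  "fdd sF V \<longleftrightarrow> (\<forall>j. \<exists>B. finite B \<and> V j = module.span sF B) \<and> (\<forall>y. \<exists>!v. is_expansion V y v)"

definition fdd_coord :: "(nat \<Rightarrow> 'b::real_normed_vector set) \<Rightarrow> 'b \<Rightarrow> nat \<Rightarrow> 'b" where
  "fdd_coord V y = (THE v. is_expansion V y v)"

definition fdd_proj :: "(nat \<Rightarrow> 'b::real_normed_vector set) \<Rightarrow> nat \<Rightarrow> 'b \<Rightarrow> 'b" where
  "fdd_proj V m y = (\<Sum>j<m. fdd_coord V y j)"

definition fdd_coproj :: "(nat \<Rightarrow> 'b::real_normed_vector set) \<Rightarrow> nat \<Rightarrow> 'b \<Rightarrow> 'b" where
  "fdd_coproj V m y = y - fdd_proj V m y"

text \<open>A series converges unconditionally if all its rearrangements converge.\<close>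

definition unconditional_fdd ::
  "('k::field \<Rightarrow> 'b::real_normed_vector \<Rightarrow> 'b) \<Rightarrow> (nat \<Rightarrow> 'b set) \<Rightarrow> bool" where
  "unconditional_fdd sF V \<longleftrightarrow>
     fdd sF V \<and> (\<forall>y \<sigma>. bij \<sigma> \<longrightarrow> summable (\<lambda>j. fdd_coord V y (\<sigma> j)))"

text \<open>
  The series on the left converges in a Banach space whenever the decomposition is unconditional,
  so \<open>suminf\<close> is its actual sum.
\<close>

definition unconditional_constant_one ::
  "('k::real_normed_field \<Rightarrow> 'b::real_normed_vector \<Rightarrow> 'b) \<Rightarrow> (nat \<Rightarrow> 'b set) \<Rightarrow> bool" where
  "unconditional_constant_one sF V \<longleftrightarrow>
     (\<forall>y \<theta>. (\<forall>j. norm (\<theta> j) \<le> 1) \<longrightarrow>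
        norm (\<Sum>j. sF (\<theta> j) (fdd_coord V y j)) \<le> norm y)"


subsection \<open>Semi \<open>M\<close>-ideals\<close>

text \<open>
  The ambient normed space is given by a carrier set \<open>X\<close> and a function \<open>nrm\<close> that need only be a
  norm on \<open>X\<close>; nothing is required outside \<open>X\<close>.
\<close>

definition ball_in :: "('v::minus \<Rightarrow> real) \<Rightarrow> 'v set \<Rightarrow> 'v \<Rightarrow> real \<Rightarrow> 'v set" where
  "ball_in nrm X x r = {y \<in> X. nrm (y - x) \<le> r}"

definition closed_subspace_in ::
  "('k::comm_ring_1 \<Rightarrow> 'v::ab_group_add \<Rightarrow> 'v) \<Rightarrow> ('v \<Rightarrow> real) \<Rightarrow> 'v set \<Rightarrow> 'v set \<Rightarrow> bool" where
  "closed_subspace_in scl nrm X J \<longleftrightarrow>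
     J \<subseteq> X \<and> module.subspace scl J \<and>
     (\<forall>x\<in>X. (\<forall>\<epsilon>>0. \<exists>y\<in>J. nrm (y - x) < \<epsilon>) \<longrightarrow> x \<in> J)"

definition two_ball_property :: "('v::minus \<Rightarrow> real) \<Rightarrow> 'v set \<Rightarrow> 'v set \<Rightarrow> bool" where
  "two_ball_property nrm X J \<longleftrightarrow>
     (\<forall>x1\<in>X. \<forall>x2\<in>X. \<forall>r1>0. \<forall>r2>0.
        ball_in nrm X x1 r1 \<inter> ball_in nrm X x2 r2 \<noteq> {} \<and>
        ball_in nrm X x1 r1 \<inter> J \<noteq> {} \<and> ball_in nrm X x2 r2 \<inter> J \<noteq> {} \<longrightarrow>
        (\<forall>\<epsilon>>0. ball_in nrm X x1 (r1 + \<epsilon>) \<inter> ball_in nrm X x2 (r2 + \<epsilon>) \<inter> J \<noteq> {}))"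

definition semi_M_ideal ::
  "('k::comm_ring_1 \<Rightarrow> 'v::ab_group_add \<Rightarrow> 'v) \<Rightarrow> ('v \<Rightarrow> real) \<Rightarrow> 'v set \<Rightarrow> 'v set \<Rightarrow> bool" where
  "semi_M_ideal scl nrm X J \<longleftrightarrow> closed_subspace_in scl nrm X J \<and> two_ball_property nrm X J"


subsection \<open>The weakly continuous polynomials form a closed subspace\<close>

text \<open>
  Hence \<open>semi_M_ideal\<close> can only fail for \<open>hom_poly_w\<close> because the 2-ball property fails.
\<close>

lemma linear_iff_over:
  assumes "normed_space_over sE" "normed_space_over sF"
  shows "Vector_Spaces.linear sE sF f \<longleftrightarrow>
    (\<forall>x y. f (x + y) = f x + f y) \<and> (\<forall>c x. f (sE c x) = sF c (f x))"
proof -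
  interpret E: normed_space_over sE by fact
  interpret F: normed_space_over sF by fact
  show ?thesis
    unfolding Vector_Spaces.linear_def module_hom_def module_hom_axioms_def
    using E.vector_space_axioms F.vector_space_axioms E.module_axioms F.module_axioms by auto
qed

lemma continuous_on_scale:
  assumes "normed_space_over sF" "continuous_on S f"
  shows "continuous_on S (\<lambda>x. sF c (f x))"
proof -
  interpret F: normed_space_over sF by fact
  have "bounded_linear (sF c)"
  proof (rule bounded_linear_intro[where K = "norm c"])
    show "sF c (x + y) = sF c x + sF c y" for x y by (rule F.scale_right_distrib)
    show "sF c (r *\<^sub>R x) = r *\<^sub>R sF c x" for r x
      by (metis F.scale_of_real F.scale_scale mult.commute)
    show "norm (sF c x) \<le> norm x * norm c" for x by (simp add: F.norm_scale)
  qed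
  then show ?thesis using assms(2) by (rule bounded_linear.continuous_on)
qed

lemma fun_scale_module:
  assumes "normed_space_over sF"
  shows "module (fun_scale sF :: _ \<Rightarrow> ('a \<Rightarrow> _) \<Rightarrow> _)"
proof -
  interpret F: normed_space_over sF by fact
  show ?thesis
    by unfold_locales
      (auto simp: fun_scale_def fun_eq_iff F.scale_right_distrib F.scale_left_distrib)
qed

lemma hom_poly_subspace:
  assumes "normed_space_over sE" "normed_space_over sF"
  shows "module.subspace (fun_scale sF) (hom_poly sE sF n)"
proof -
  interpret F: normed_space_over sF by fact
  note L = linear_iff_over[OF assms]
  show ?thesis
    unfolding module.subspace_def[OF fun_scale_module[OF assms(2)]]
  proof (intro conjI ballI allI)
    show "0 \<in> hom_poly sE sF n"
      unfolding hom_poly_def multilinear_on_def L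
      by (auto intro!: exI[of _ "\<lambda>_. 0"] simp: zero_fun_def)
  next
    fix P Q assume "P \<in> hom_poly sE sF n" "Q \<in> hom_poly sE sF n"
    then obtain A B where "multilinear_on sE sF n A" "\<forall>x. P x = A (\<lambda>_. x)" "continuous_on UNIV P"
      "multilinear_on sE sF n B" "\<forall>x. Q x = B (\<lambda>_. x)" "continuous_on UNIV Q"
      by (auto simp: hom_poly_def)
    then show "P + Q \<in> hom_poly sE sF n"
      unfolding hom_poly_def multilinear_on_def L plus_fun_def mem_Collect_eq
      by (intro conjI continuous_on_add exI[of _ "\<lambda>v. A v + B v"])
        (simp_all add: F.scale_right_distrib, metis)
  next
    fix c P assume "P \<in> hom_poly sE sF n"
    then obtain A where "multilinear_on sE sF n A" "\<forall>x. P x = A (\<lambda>_. x)" "continuous_on UNIV P"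
      by (auto simp: hom_poly_def)
    then show "fun_scale sF c P \<in> hom_poly sE sF n"
      unfolding hom_poly_def multilinear_on_def L fun_scale_def mem_Collect_eq
      by (intro conjI continuous_on_scale[OF assms(2)] exI[of _ "\<lambda>v. sF c (A v)"])
        (auto simp: F.scale_right_distrib mult.commute)
  qed
qed

lemma multilinear_on_diag_scale:
  assumes "normed_space_over sE" "normed_space_over sF" "multilinear_on sE sF n A"
  shows "A (\<lambda>_. sE c x) = sF (c ^ n) (A (\<lambda>_. x))"
proof -
  interpret F: normed_space_over sF by fact
  note L = linear_iff_over[OF assms(1,2)]
  have "A (\<lambda>i. if i < m then sE c x else x) = sF (c ^ m) (A (\<lambda>_. x))" if "m \<le> n" for m
    using that
  proof (induction m)
    case (Suc m)
    have "(\<lambda>i. if i < Suc m then sE c x else x) = (\<lambda>i. if i < m then sE c x else x)(m := sE c x)"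
      "(\<lambda>i. if i < m then sE c x else x)(m := x) = (\<lambda>i. if i < m then sE c x else x)"
      by (auto simp: fun_eq_iff)
    then have "A (\<lambda>i. if i < Suc m then sE c x else x) = sF c (A (\<lambda>i. if i < m then sE c x else x))"
      using assms(3) Suc.prems unfolding multilinear_on_def L by (metis Suc_le_eq)
    then show ?case using Suc by simp
  qed simp
  from this[of n] show ?thesis
    using assms(3) unfolding multilinear_on_def by (smt (verit) order_refl)
qed

lemma hom_poly_homogeneous:
  assumes "normed_space_over sE" "normed_space_over sF" "P \<in> hom_poly sE sF n"
  shows "P (r *\<^sub>R x) = r ^ n *\<^sub>R P x"
proof -
  interpret E: normed_space_over sE by fact
  interpret F: normed_space_over sF by fact
  obtain A where A: "multilinear_on sE sF n A" "\<And>x. P x = A (\<lambda>_. x)"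
    using assms(3) by (auto simp: hom_poly_def)
  from multilinear_on_diag_scale[OF assms(1,2) A(1), of "of_real r" x] show ?thesis
    by (simp add: A(2) E.scale_of_real F.scale_of_real flip: of_real_power)
qed

lemma hom_poly_bdd_above:
  assumes "normed_space_over sE" "normed_space_over sF" "P \<in> hom_poly sE sF n"
  shows "bdd_above ((\<lambda>x. norm (P x)) ` cball 0 1)"
proof -
  have "isCont P 0"
    using assms(3) by (auto simp: hom_poly_def continuous_on_eq_continuous_at)
  then obtain d where d: "d > 0" "\<And>x. norm x < d \<Longrightarrow> norm (P x - P 0) < 1"
    unfolding continuous_at_eps_delta by (auto dest!: spec[of _ 1] simp: dist_norm)
  have "norm (P x) \<le> (2 / d) ^ n * (1 + norm (P 0))" if "norm x \<le> 1" for x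
  proof -
    have "norm (P ((d / 2) *\<^sub>R x) - P 0) < 1"
      using that d(1) by (intro d(2)) (auto simp: mult_le_cancel_left1 intro: le_less_trans[of _ "d / 2 * 1"])
    then have "norm (P ((d / 2) *\<^sub>R x)) \<le> 1 + norm (P 0)"
      using norm_triangle_sub[of "P ((d / 2) *\<^sub>R x)" "P 0"] by linarith
    then have "(2 / d) ^ n * norm (P ((d / 2) *\<^sub>R x)) \<le> (2 / d) ^ n * (1 + norm (P 0))"
      using d(1) by (intro mult_left_mono) auto
    then show ?thesis
      using d(1) by (simp add: hom_poly_homogeneous[OF assms] power_divide)
  qed
  then show ?thesis by (intro bdd_aboveI2) auto
qed

lemma norm_le_poly_norm:
  assumes "normed_space_over sE" "normed_space_over sF" "P \<in> hom_poly sE sF n"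
    and "norm x \<le> r" "r > 0"
  shows "norm (P x) \<le> r ^ n * poly_norm P"
proof -
  have "norm (P ((1 / r) *\<^sub>R x)) \<le> poly_norm P"
    unfolding poly_norm_def using assms(4,5)
    by (intro cSUP_upper hom_poly_bdd_above[OF assms(1-3)]) auto
  then have "r ^ n * norm (P ((1 / r) *\<^sub>R x)) \<le> r ^ n * poly_norm P"
    using assms(5) by (intro mult_left_mono) auto
  then show ?thesis
    using assms(5) by (simp add: hom_poly_homogeneous[OF assms(1-3)] power_divide)
qed

lemma tendsto_scale:
  assumes "normed_space_over sF" "(f \<longlongrightarrow> l) G"
  shows "((\<lambda>x. sF c (f x)) \<longlongrightarrow> sF c l) G"
  using continuous_on_scale[OF assms(1) continuous_on_id, of UNIV c] assms(2)
  by (auto simp: continuous_on_eq_continuous_at intro: isCont_tendsto_compose)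

lemma hom_poly_w_closed_subspace:
  assumes "normed_space_over sE" "normed_space_over sF"
  shows "closed_subspace_in (fun_scale sF) poly_norm (hom_poly sE sF n) (hom_poly_w sE sF n)"
proof -
  note sub = module.subspace_def[OF fun_scale_module[OF assms(2)]]
  have X: "0 \<in> hom_poly sE sF n"
    "\<And>P Q. P \<in> hom_poly sE sF n \<Longrightarrow> Q \<in> hom_poly sE sF n \<Longrightarrow> P + Q \<in> hom_poly sE sF n"
    "\<And>c P. P \<in> hom_poly sE sF n \<Longrightarrow> fun_scale sF c P \<in> hom_poly sE sF n"
    using hom_poly_subspace[OF assms, of n] unfolding sub by blast+
  have diff: "P - Q \<in> hom_poly sE sF n" if "P \<in> hom_poly sE sF n" "Q \<in> hom_poly sE sF n" for P Q
    using module.subspace_diff[OF fun_scale_module[OF assms(2)] hom_poly_subspace[OF assms] that] .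
  have W: "weakly_continuous_on_bounded sE P \<longleftrightarrow>
      (\<forall>G x B. bounded B \<and> (\<forall>\<^sub>F y in G. y \<in> B) \<and> weakly_converges sE x G \<longrightarrow> (P \<longlongrightarrow> P x) G)"
    for P :: "'b \<Rightarrow> 'c"
    unfolding weakly_continuous_on_bounded_def
    by (simp add: tendsto_norm_zero_iff LIM_zero_iff)
  show ?thesis
    unfolding closed_subspace_in_def sub
  proof (intro conjI ballI allI impI)
    show "hom_poly_w sE sF n \<subseteq> hom_poly sE sF n" by (auto simp: hom_poly_w_def)
    show "0 \<in> hom_poly_w sE sF n" using X(1) by (auto simp: hom_poly_w_def W zero_fun_def)
    show "P + Q \<in> hom_poly_w sE sF n"
      if "P \<in> hom_poly_w sE sF n" "Q \<in> hom_poly_w sE sF n" for P Q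
      using that X(2)[of P Q] unfolding hom_poly_w_def W plus_fun_def by (blast intro: tendsto_add)
    show "fun_scale sF c P \<in> hom_poly_w sE sF n" if "P \<in> hom_poly_w sE sF n" for c P
      using that X(3)[of P c] unfolding hom_poly_w_def W fun_scale_def
      by (blast intro: tendsto_scale[OF assms(2)])
  next
    fix P assume P: "P \<in> hom_poly sE sF n"
      and lim: "\<forall>\<epsilon>>0. \<exists>Q\<in>hom_poly_w sE sF n. poly_norm (Q - P) < \<epsilon>"
    have "(P \<longlongrightarrow> P x) G" if B: "bounded B" "\<forall>\<^sub>F y in G. y \<in> B" and G: "weakly_converges sE x G" for G x B
    proof (rule tendstoI)
      fix e :: real assume "e > 0"
      obtain r where r: "r > 0" "norm x \<le> r" "\<And>y. y \<in> B \<Longrightarrow> norm y \<le> r"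
        using bounded_insert[of x B] B(1) bounded_pos[of "insert x B"] by auto
      define \<epsilon> where "\<epsilon> = e / 3 / r ^ n"
      have "\<epsilon> > 0" using \<open>e > 0\<close> r(1) by (simp add: \<epsilon>_def)
      with lim obtain Q where Q: "Q \<in> hom_poly_w sE sF n" "poly_norm (Q - P) < \<epsilon>" by blast
      have near: "dist (Q y) (P y) < e / 3" if "norm y \<le> r" for y
      proof -
        have "norm ((Q - P) y) \<le> r ^ n * poly_norm (Q - P)"
          using Q(1) P r(1) that by (intro norm_le_poly_norm[OF assms] diff) (auto simp: hom_poly_w_def)
        also have "\<dots> < r ^ n * \<epsilon>" using Q(2) r(1) by (intro mult_strict_left_mono) auto
        finally show ?thesis using r(1) by (simp add: \<epsilon>_def dist_norm)
      qed
      have "(Q \<longlongrightarrow> Q x) G" using Q(1) B G unfolding hom_poly_w_def W by blast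
      then have "\<forall>\<^sub>F y in G. dist (Q y) (Q x) < e / 3" using \<open>e > 0\<close> by (intro tendstoD) auto
      with B(2) show "\<forall>\<^sub>F y in G. dist (P y) (P x) < e"
      proof eventually_elim
        case (elim y)
        have "dist (P y) (P x) \<le> dist (Q y) (P y) + dist (Q y) (Q x) + dist (Q x) (P x)"
          using dist_triangle[of "P y" "P x" "Q y"] dist_triangle[of "Q y" "P x" "Q x"]
          by (simp add: dist_commute)
        then show ?case using near[of y] near[of x] r elim by fastforce
      qed
    qed
    with P show "P \<in> hom_poly_w sE sF n" unfolding hom_poly_w_def W by blast
  qed
qed

end

theory Submission
  imports Defs
begin

text \<open>
  Apply the 2-ball property to \<open>P + Q\<close> and \<open>P - Q\<close> with radius \<open>\<parallel>P\<parallel>\<close>: both balls contain \<open>P\<close>, and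
  they meet \<open>J = P\<^sub>w\<close> in \<open>Q\<close> and \<open>- Q\<close>. A point \<open>R \<in> J\<close> of the enlarged balls gives \<open>a = P + Q - R\<close>
  and \<open>b = P - Q - R\<close> of norm at most \<open>\<parallel>P\<parallel> + \<epsilon> < \<delta>\<close>, and
  \<open>\<pi>\<^sup>mP + Q = (a + (\<pi>\<^sup>m - \<pi>\<^sub>m) b) / 2 + \<pi>\<^sup>m(Q + R)\<close>. The map \<open>\<pi>\<^sup>m - \<pi>\<^sub>m\<close> is a contraction, so hypothesis
  (2) is violated once \<open>\<pi>\<^sup>m(Q + R) \<rightarrow> 0\<close> uniformly on the unit ball. This holds for every polynomial \<open>f\<close>
  that is weakly continuous on bounded sets, by induction on the degree: in
  \<open>f x = (f (x - t) - f 0) + f 0 + (f (x - t + t) - f (x - t))\<close> with \<open>t\<close> taken from a finite weak net of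
  the ball, the first bracket is uniformly small and the last one is a polynomial of lower degree
  in \<open>x - t\<close>.
\<close>

section \<open>Finite weak nets\<close>

lemma normed_space_over_self:
  "normed_space_over ((*) :: 'k::real_normed_field \<Rightarrow> 'k \<Rightarrow> 'k)"
  by unfold_locales (auto simp: algebra_simps norm_mult scaleR_conv_of_real)

lemma dual_space_linear:
  assumes "normed_space_over sE" "\<phi> \<in> dual_space sE"
  shows "\<phi> (x + y) = \<phi> x + \<phi> y" "\<phi> (x - y) = \<phi> x - \<phi> y" "\<phi> 0 = 0"
proof -
  have "Vector_Spaces.linear sE (*) \<phi>"
    using assms(2) by (simp add: dual_space_def)
  then interpret Vector_Spaces.linear sE "(*)" \<phi> .
  show "\<phi> (x + y) = \<phi> x + \<phi> y" "\<phi> (x - y) = \<phi> x - \<phi> y" "\<phi> 0 = 0"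
    by (rule add diff zero)+
qed

text \<open>A functional is a 1-homogeneous polynomial, so the norm bound for polynomials applies to
  it.\<close>

lemma dual_space_bounded_image:
  assumes E: "normed_space_over sE" and \<phi>: "\<phi> \<in> dual_space sE" and S: "bounded S"
  shows "bounded (\<phi> ` S)"
proof -
  have "\<phi> \<in> hom_poly sE (*) 1"
    using \<phi> unfolding hom_poly_def multilinear_on_def dual_space_def
    by (auto intro!: exI[of _ "\<lambda>v. \<phi> (v 0)"])
  moreover obtain r where "r > 0" "\<And>x. x \<in> S \<Longrightarrow> norm x \<le> r"
    using S by (auto simp: bounded_pos)
  ultimately have "norm (\<phi> x) \<le> r ^ 1 * poly_norm \<phi>" if "x \<in> S" for x
    using that by (intro norm_le_poly_norm[OF E normed_space_over_self]) auto
  then show ?thesis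
    unfolding bounded_iff by blast
qed

text \<open>Each \<phi> in \<open>\<Phi>\<close> maps \<open>S\<close> onto a totally bounded set of
  scalars, covered by finitely many balls of radius \<open>\<eta> / 2\<close>. Classifying points of
  \<open>S\<close> by one such ball for each \<phi> leaves finitely many classes, and one
  representative of each class gives \<open>T\<close>.\<close>

lemma finite_weak_net:
  fixes sE :: "'k::{real_normed_field,heine_borel} \<Rightarrow> 'a::real_normed_vector \<Rightarrow> 'a"
  assumes E: "normed_space_over sE" and S: "bounded S"
    and \<Phi>: "finite \<Phi>" "\<Phi> \<subseteq> dual_space sE" and "\<eta> > 0"
  obtains T where "finite T" "T \<subseteq> S" "\<And>x. x \<in> S \<Longrightarrow> \<exists>t\<in>T. \<forall>\<phi>\<in>\<Phi>. norm (\<phi> (x - t)) < \<eta>"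
proof -
  have "\<exists>C. finite C \<and> \<phi> ` S \<subseteq> (\<Union>c\<in>C. ball c (\<eta> / 2))" if "\<phi> \<in> \<Phi>" for \<phi>
  proof -
    have "compact (closure (\<phi> ` S))"
      using dual_space_bounded_image[OF E _ S] that \<Phi>(2) by (auto simp: compact_closure)
    then have "seq_compact (closure (\<phi> ` S))"
      by (simp add: compact_eq_seq_compact_metric)
    from seq_compact_imp_totally_bounded[OF this, rule_format, of "\<eta> / 2"] \<open>\<eta> > 0\<close>
    obtain C where "finite C" "closure (\<phi> ` S) \<subseteq> (\<Union>c\<in>C. ball c (\<eta> / 2))"
      by auto
    then show ?thesis using closure_subset[of "\<phi> ` S"] by (meson subset_trans)
  qed
  then obtain C where C: "\<And>\<phi>. \<phi> \<in> \<Phi> \<Longrightarrow> finite (C \<phi>)"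
    "\<And>\<phi>. \<phi> \<in> \<Phi> \<Longrightarrow> \<phi> ` S \<subseteq> (\<Union>c\<in>C \<phi>. ball c (\<eta> / 2))"
    by metis
  \<comment> \<open>\<open>g x\<close> is the class of \<open>x\<close>: a choice of centre for each
    \<phi>. The restriction to \<open>\<Phi>\<close> places it in a finite product.\<close>
  define g where "g x = restrict (\<lambda>\<phi>. SOME c. c \<in> C \<phi> \<and> \<phi> x \<in> ball c (\<eta> / 2)) \<Phi>" for x
  have g: "g x \<phi> \<in> C \<phi>" "\<phi> x \<in> ball (g x \<phi>) (\<eta> / 2)" if "x \<in> S" "\<phi> \<in> \<Phi>" for x \<phi>
  proof -
    have "\<exists>c. c \<in> C \<phi> \<and> \<phi> x \<in> ball c (\<eta> / 2)" using C(2) that by blast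
    from someI_ex[OF this] show "g x \<phi> \<in> C \<phi>" "\<phi> x \<in> ball (g x \<phi>) (\<eta> / 2)"
      using that by (simp_all add: g_def)
  qed
  have "g ` S \<subseteq> Pi\<^sub>E \<Phi> C"
    using g(1) by (auto simp: g_def)
  then have "finite (g ` S)"
    using finite_PiE[OF \<Phi>(1), of C] C(1) finite_subset by blast
  then obtain T where T: "finite T" "T \<subseteq> S" "g ` S = g ` T"
    using finite_subset_image[of "g ` S" g S] by auto
  show ?thesis
  proof (rule that[OF T(1,2)])
    fix x assume x: "x \<in> S"
    then obtain t where t: "t \<in> T" "g x = g t" using T(3) by blast
    have "norm (\<phi> (x - t)) < \<eta>" if "\<phi> \<in> \<Phi>" for \<phi>
    proof -
      have "dist (g x \<phi>) (\<phi> x) < \<eta> / 2" "dist (g x \<phi>) (\<phi> t) < \<eta> / 2"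
        using g(2)[OF x that] g(2)[of t \<phi>] T(2) t that by auto
      then have "dist (\<phi> x) (\<phi> t) < \<eta>"
        using dist_triangle_half_r by metis
      then show ?thesis
        using dual_space_linear(2)[OF E, of \<phi>] \<Phi>(2) that by (auto simp: dist_norm)
    qed
    then show "\<exists>t\<in>T. \<forall>\<phi>\<in>\<Phi>. norm (\<phi> (x - t)) < \<eta>" using t(1) by blast
  qed
qed

section \<open>Weak neighbourhoods of 0 and weak continuity on bounded sets\<close>

lemma eventually_INF_filtercomap_nhds_0:
  fixes \<Phi> :: "('a \<Rightarrow> 'k::real_normed_vector) set"
  assumes "finite \<Phi>" "eventually R (INF \<phi>\<in>\<Phi>. filtercomap \<phi> (nhds 0))"
  shows "\<exists>\<eta>>0. \<forall>y. (\<forall>\<phi>\<in>\<Phi>. norm (\<phi> y) < \<eta>) \<longrightarrow> R y"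
  using assms
proof (induction \<Phi> arbitrary: R rule: finite_induct)
  case empty
  then show ?case by (auto intro!: exI[of _ 1])
next
  case (insert \<phi> \<Phi>)
  then obtain R1 R2 where R: "eventually R1 (filtercomap \<phi> (nhds 0))"
    "eventually R2 (INF \<phi>\<in>\<Phi>. filtercomap \<phi> (nhds 0))" "\<And>y. R1 y \<Longrightarrow> R2 y \<Longrightarrow> R y"
    by (auto simp: eventually_inf)
  obtain \<eta>1 where \<eta>1: "\<eta>1 > 0" "\<And>y. norm (\<phi> y) < \<eta>1 \<Longrightarrow> R1 y"
    using R(1) unfolding eventually_filtercomap eventually_nhds_metric by (auto simp: dist_norm)
  obtain \<eta>2 where \<eta>2: "\<eta>2 > 0" "\<And>y. (\<forall>\<phi>\<in>\<Phi>. norm (\<phi> y) < \<eta>2) \<Longrightarrow> R2 y"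
    using insert.IH[OF R(2)] by blast
  show ?case
    using \<eta>1 \<eta>2 R(3) by (intro exI[of _ "min \<eta>1 \<eta>2"]) auto
qed

lemma weakly_continuous_on_bounded_iff:
  "weakly_continuous_on_bounded sE f \<longleftrightarrow>
    (\<forall>G x B. bounded B \<longrightarrow> (\<forall>\<^sub>F y in G. y \<in> B) \<longrightarrow> weakly_converges sE x G \<longrightarrow> (f \<longlongrightarrow> f x) G)"
  unfolding weakly_continuous_on_bounded_def by (auto simp: tendsto_norm_zero_iff LIM_zero_iff)

text \<open>Turns the filter condition into an estimate: an event in an infimum of filters already
  holds for finitely many of them, here finitely many functionals.\<close>

lemma weakly_continuous_on_bounded_at_0:
  assumes E: "normed_space_over sE" and f: "weakly_continuous_on_bounded sE f"
    and "bounded B" "e > 0"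
  obtains \<Phi> \<eta> where "finite \<Phi>" "\<Phi> \<subseteq> dual_space sE" "\<eta> > 0"
    "\<And>y. y \<in> B \<Longrightarrow> (\<And>\<phi>. \<phi> \<in> \<Phi> \<Longrightarrow> norm (\<phi> y) < \<eta>) \<Longrightarrow> norm (f y - f 0) < e"
proof -
  \<comment> \<open>\<open>W\<close> is the filter of weak neighbourhoods of 0; the infimum with
    \<open>principal B\<close> is the coarsest bounded test filter living on
    \<open>B\<close>.\<close>
  define W where "W = (INF \<phi>\<in>dual_space sE. filtercomap \<phi> (nhds 0))"
  have "weakly_converges sE 0 (inf W (principal B))"
    unfolding weakly_converges_def
  proof
    fix \<phi> assume \<phi>: "\<phi> \<in> dual_space sE"
    have "W \<le> filtercomap \<phi> (nhds 0)" unfolding W_def by (rule INF_lower[OF \<phi>])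
    then show "(\<phi> \<longlongrightarrow> \<phi> 0) (inf W (principal B))"
      unfolding dual_space_linear(3)[OF E \<phi>] filterlim_iff_le_filtercomap
      by (rule le_infI1)
  qed
  moreover have "\<forall>\<^sub>F y in inf W (principal B). y \<in> B"
    by (simp add: eventually_inf_principal)
  ultimately have "(f \<longlongrightarrow> f 0) (inf W (principal B))"
    using f \<open>bounded B\<close> unfolding weakly_continuous_on_bounded_iff by blast
  then have "\<forall>\<^sub>F y in W. y \<in> B \<longrightarrow> norm (f y - f 0) < e"
    using \<open>e > 0\<close> by (auto simp: tendsto_iff dist_norm eventually_inf_principal)
  then obtain \<Phi> where \<Phi>: "finite \<Phi>" "\<Phi> \<subseteq> dual_space sE"
    "\<forall>\<^sub>F y in (INF \<phi>\<in>\<Phi>. filtercomap \<phi> (nhds 0)). y \<in> B \<longrightarrow> norm (f y - f 0) < e"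
    unfolding W_def eventually_INF[of _ _ "dual_space sE"] by blast
  obtain \<eta> where \<eta>: "\<eta> > 0" "\<forall>y. (\<forall>\<phi>\<in>\<Phi>. norm (\<phi> y) < \<eta>) \<longrightarrow> y \<in> B \<longrightarrow> norm (f y - f 0) < e"
    using eventually_INF_filtercomap_nhds_0[OF \<Phi>(1,3)] by blast
  show ?thesis
    using \<eta>(2) by (intro that[OF \<Phi>(1,2) \<eta>(1)]) simp
qed

text \<open>Translations preserve boundedness and weak convergence. This keeps the hypothesis alive
  when the induction on the degree passes to differences.\<close>

lemma weakly_continuous_on_bounded_difference:
  assumes E: "normed_space_over sE" and f: "weakly_continuous_on_bounded sE f"
  shows "weakly_continuous_on_bounded sE (\<lambda>x. f (x + a) - f x)"
  unfolding weakly_continuous_on_bounded_iff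
proof (intro allI impI)
  fix G x B
  assume B: "bounded B" "\<forall>\<^sub>F y in G. y \<in> B" and G: "weakly_converges sE x G"
  have "weakly_converges sE (x + a) (filtermap (\<lambda>y. y + a) G)"
    using G unfolding weakly_converges_def
    by (auto simp: filterlim_filtermap dual_space_linear(1)[OF E] intro!: tendsto_add)
  moreover have "bounded ((\<lambda>y. y + a) ` B)"
    using bounded_translation[OF B(1), of a] by (simp add: add.commute)
  moreover have "\<forall>\<^sub>F y in filtermap (\<lambda>y. y + a) G. y \<in> (\<lambda>y. y + a) ` B"
    using B(2) by (auto simp: eventually_filtermap elim: eventually_mono)
  ultimately have "(f \<longlongrightarrow> f (x + a)) (filtermap (\<lambda>y. y + a) G)"
    using f unfolding weakly_continuous_on_bounded_iff by blast
  moreover have "(f \<longlongrightarrow> f x) G"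
    using f B G unfolding weakly_continuous_on_bounded_iff by blast
  ultimately show "((\<lambda>x. f (x + a) - f x) \<longlongrightarrow> f (x + a) - f x) G"
    by (intro tendsto_diff) (auto simp: filterlim_filtermap)
qed


section \<open>Degree by iterated differences\<close>

text \<open>Frechet's notion of a polynomial of degree below \<open>k\<close>: all
  \<open>k\<close>-fold differences vanish. Differences of a homogeneous polynomial are in general
  not homogeneous, so the induction runs over this class.\<close>

fun diff_degree_less :: "nat \<Rightarrow> ('a::ab_group_add \<Rightarrow> 'b::ab_group_add) \<Rightarrow> bool" where
  "diff_degree_less 0 f \<longleftrightarrow> (\<forall>x. f x = 0)"
| "diff_degree_less (Suc k) f \<longleftrightarrow> (\<forall>a. diff_degree_less k (\<lambda>x. f (x + a) - f x))"

lemma diff_degree_less_zero: "diff_degree_less k (\<lambda>_. 0)"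
  by (induction k) auto

lemma diff_degree_less_add:
  "diff_degree_less k f \<Longrightarrow> diff_degree_less k g \<Longrightarrow> diff_degree_less k (\<lambda>x. f x + g x)"
proof (induction k arbitrary: f g)
  case (Suc k)
  have "diff_degree_less k (\<lambda>x. (f (x + a) - f x) + (g (x + a) - g x))" for a
    using Suc by simp
  then show ?case by (simp add: algebra_simps)
qed simp

text \<open>
  The shifts \<open>v i\<close> make this class of functions closed under translation, so that telescoping over
  \<open>I\<close> expresses a difference by functions of the same kind with one variable slot fewer.
\<close>

lemma multilinear_on_diff_degree:
  assumes EF: "normed_space_over sE" "normed_space_over sF" and A: "multilinear_on sE sF n A"
    and "I \<subseteq> {..<n}" "card I = k"
  shows "diff_degree_less (Suc k) (\<lambda>x. A (\<lambda>i. if i \<in> I then x + v i else v i))"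
  using assms(4,5)
proof (induction k arbitrary: I v)
  case 0
  then have "I = {}" using finite_subset by fastforce
  then show ?case by simp
next
  case (Suc k)
  have diff: "A (u(i := y)) - A (u(i := z)) = A (u(i := y - z))" if "i < n" for u i y z
  proof -
    have "A (u(i := (y - z) + z)) = A (u(i := y - z)) + A (u(i := z))"
      using A that unfolding multilinear_on_def linear_iff_over[OF EF] by blast
    then show ?thesis by simp
  qed
  have fin: "finite I" using Suc.prems(1) finite_subset by blast
  \<comment> \<open>The shifts \<open>v\<close> are replaced by \<open>w\<close> one index at a
    time; \<open>H\<close> collects the indices already changed.\<close>
  have tele: "diff_degree_less (Suc k) (\<lambda>x. A (\<lambda>i. if i \<in> I then x + (if i \<in> H then w i else v i) else v i)
      - A (\<lambda>i. if i \<in> I then x + v i else v i))" if "finite H" "H \<subseteq> I" for H w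
    using that
  proof (induction H rule: finite_induct)
    case empty
    then show ?case by (simp add: diff_degree_less_zero cong: if_cong del: diff_degree_less.simps)
  next
    case (insert j H)
    define u where "u = (\<lambda>i. if i \<in> H then w i else v i)"
    have j: "j < n" "j \<in> I" using insert.prems Suc.prems by auto
    have eq: "(\<lambda>i. if i \<in> I then x + (if i \<in> insert j H then w i else v i) else v i)
        = (\<lambda>i. if i \<in> I then x + u i else v i)(j := x + w j)"
      "(\<lambda>i. if i \<in> I then x + u i else v i)
        = (\<lambda>i. if i \<in> I then x + u i else v i)(j := x + v j)"
      "(\<lambda>i. if i \<in> I then x + u i else v i)(j := w j - v j)
        = (\<lambda>i. if i \<in> I - {j} then x + (if i \<in> I - {j} then u i else if i = j then w j - v j else v i)
             else (if i \<in> I - {j} then u i else if i = j then w j - v j else v i))" for x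
      using j insert.hyps by (auto simp: fun_eq_iff u_def)
    \<comment> \<open>In slot \<open>j\<close> the difference of \<open>x + w j\<close> and
      \<open>x + v j\<close> is free of \<open>x\<close>. Only the \<open>k\<close> slots of
      \<open>I - {j}\<close> still depend on \<open>x\<close>, so the outer induction hypothesis
      applies.\<close>
    have "diff_degree_less (Suc k) (\<lambda>x. A ((\<lambda>i. if i \<in> I then x + u i else v i)(j := w j - v j)))"
      unfolding eq(3) using Suc.prems j fin by (intro Suc.IH) auto
    moreover have "A ((\<lambda>i. if i \<in> I then x + u i else v i)(j := w j - v j))
        = A (\<lambda>i. if i \<in> I then x + (if i \<in> insert j H then w i else v i) else v i)
          - A (\<lambda>i. if i \<in> I then x + u i else v i)" for x
      unfolding eq(1) by (subst (3) eq(2)) (simp add: diff[OF j(1)])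
    ultimately have "diff_degree_less (Suc k)
        (\<lambda>x. A (\<lambda>i. if i \<in> I then x + (if i \<in> insert j H then w i else v i) else v i)
          - A (\<lambda>i. if i \<in> I then x + u i else v i))" by (simp del: diff_degree_less.simps)
    from diff_degree_less_add[OF this insert.IH] insert.prems show ?case
      by (simp add: u_def cong: if_cong del: diff_degree_less.simps)
  qed
  have "diff_degree_less (Suc k) (\<lambda>x. A (\<lambda>i. if i \<in> I then (x + a) + v i else v i)
      - A (\<lambda>i. if i \<in> I then x + v i else v i))" for a
  proof -
    \<comment> \<open>Translating \<open>x\<close> by \<open>a\<close> amounts to changing every
      shift \<open>v i\<close> into \<open>a + v i\<close>, the telescope with
      \<open>H = I\<close>.\<close>
    have "(\<lambda>i. if i \<in> I then x + (if i \<in> I then a + v i else v i) else v i)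
        = (\<lambda>i. if i \<in> I then (x + a) + v i else v i)" for x
      by (auto simp: fun_eq_iff add.assoc)
    with tele[OF fin subset_refl, of "\<lambda>i. a + v i"] show ?thesis by simp
  qed
  then show ?case by (subst diff_degree_less.simps) blast
qed

text \<open>The case of all \<open>n\<close> slots variable and all shifts zero; \<open>A\<close>
  ignores the values outside these slots.\<close>

lemma hom_poly_diff_degree:
  assumes "normed_space_over sE" "normed_space_over sF" "f \<in> hom_poly sE sF n"
  shows "diff_degree_less (Suc n) f"
proof -
  obtain A where A: "multilinear_on sE sF n A" "\<And>x. f x = A (\<lambda>_. x)"
    using assms(3) by (auto simp: hom_poly_def)
  have "\<And>v w. (\<forall>i<n. v i = w i) \<Longrightarrow> A v = A w"
    using A(1) by (simp add: multilinear_on_def)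
  from this[of "\<lambda>i. if i \<in> {..<n} then x + 0 else 0" "\<lambda>_. x" for x]
  have "A (\<lambda>i. if i \<in> {..<n} then x + 0 else 0) = f x" for x
    by (simp add: A(2))
  with multilinear_on_diff_degree[OF assms(1,2) A(1) subset_refl, of n "\<lambda>_. 0"]
  show ?thesis by (simp del: diff_degree_less.simps)
qed


section \<open>Uniform convergence on bounded sets\<close>

text \<open>\<open>T\<close> stands for the projections \<pi>^m; only additivity, contractivity and
  pointwise convergence to 0 enter. The radius varies in the induction because \<open>x - t\<close>
  ranges over a ball twice as large.\<close>

lemma uniform_limit_weakly_continuous_polynomial:
  fixes sE :: "'k::{real_normed_field,heine_borel} \<Rightarrow> 'a::real_normed_vector \<Rightarrow> 'a"
    and T :: "nat \<Rightarrow> 'b::real_normed_vector \<Rightarrow> 'b"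
  assumes E: "normed_space_over sE"
    and T: "\<And>m x y. T m (x + y) = T m x + T m y" "\<And>m y. norm (T m y) \<le> norm y"
      "\<And>y. (\<lambda>m. T m y) \<longlonglongrightarrow> 0"
    and f: "weakly_continuous_on_bounded sE f" "diff_degree_less k f"
  shows "uniform_limit (cball 0 r) (\<lambda>m x. T m (f x)) (\<lambda>_. 0) sequentially"
  using f
proof (induction k arbitrary: f r)
  case 0
  then show ?case using T(2)[of _ 0] by (simp add: uniform_limit_iff)
next
  case (Suc k)
  show ?case
  proof (rule uniform_limitI)
    fix e :: real assume "e > 0"
    then have "e / 3 > 0" by simp
    obtain \<Phi> \<eta> where \<Phi>: "finite \<Phi>" "\<Phi> \<subseteq> dual_space sE" "\<eta> > 0" and
      small: "\<And>y. y \<in> cball 0 (2 * r) \<Longrightarrow> (\<And>\<phi>. \<phi> \<in> \<Phi> \<Longrightarrow> norm (\<phi> y) < \<eta>) \<Longrightarrow> norm (f y - f 0) < e / 3"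
      using weakly_continuous_on_bounded_at_0[OF E Suc.prems(1) bounded_cball \<open>e / 3 > 0\<close>] by metis
    obtain N where N: "finite N" "N \<subseteq> cball 0 r"
      "\<And>x. x \<in> cball 0 r \<Longrightarrow> \<exists>t\<in>N. \<forall>\<phi>\<in>\<Phi>. norm (\<phi> (x - t)) < \<eta>"
      using finite_weak_net[OF E bounded_cball \<Phi>] by metis
    have "\<forall>\<^sub>F m in sequentially. \<forall>y\<in>cball 0 (2 * r). dist (T m (f (y + t) - f y)) 0 < e / 3" for t
      using Suc.IH[OF weakly_continuous_on_bounded_difference[OF E Suc.prems(1)]] Suc.prems(2)
        \<open>e / 3 > 0\<close> by (intro uniform_limitD) auto
    \<comment> \<open>Finiteness of the net gives one threshold for \<open>m\<close> serving all
      \<open>t\<close>.\<close>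
    then have "\<forall>\<^sub>F m in sequentially. \<forall>t\<in>N. \<forall>y\<in>cball 0 (2 * r). dist (T m (f (y + t) - f y)) 0 < e / 3"
      by (intro eventually_ball_finite N(1)) auto
    moreover have "\<forall>\<^sub>F m in sequentially. dist (T m (f 0)) 0 < e / 3"
      using T(3) \<open>e / 3 > 0\<close> by (rule tendstoD)
    ultimately show "\<forall>\<^sub>F m in sequentially. \<forall>x\<in>cball 0 r. dist (T m (f x)) 0 < e"
    proof eventually_elim
      case (elim m)
      show ?case
      proof
        fix x :: 'a assume x: "x \<in> cball 0 r"
        obtain t where t: "t \<in> N" "\<forall>\<phi>\<in>\<Phi>. norm (\<phi> (x - t)) < \<eta>" using N(3)[OF x] by blast
        have y: "x - t \<in> cball 0 (2 * r)"
          using x t(1) N(2) norm_triangle_ineq4[of x t] by fastforce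
        have "T m (f x) = T m ((f (x - t) - f 0) + f 0 + (f (x - t + t) - f (x - t)))" by simp
        also have "\<dots> = T m (f (x - t) - f 0) + T m (f 0) + T m (f (x - t + t) - f (x - t))"
          by (simp only: T(1))
        also have "norm \<dots> \<le> norm (T m (f (x - t) - f 0)) + norm (T m (f 0))
            + norm (T m (f (x - t + t) - f (x - t)))"
          by (intro norm_triangle_mono order_refl)
        also have "\<dots> < e / 3 + e / 3 + e / 3"
        proof (intro add_strict_mono)
          show "norm (T m (f (x - t) - f 0)) < e / 3"
            using T(2)[of m "f (x - t) - f 0"] small[OF y] t(2) by force
          show "norm (T m (f 0)) < e / 3" using elim(2) by simp
          show "norm (T m (f (x - t + t) - f (x - t))) < e / 3"
            using bspec[OF bspec[OF elim(1) t(1)] y] by simp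
        qed
        finally show "dist (T m (f x)) 0 < e" by simp
      qed
    qed
  qed
qed


section \<open>Unconditional decompositions with constant one\<close>

lemma fdd_coord_expansion:
  assumes "fdd sF V"
  shows "is_expansion V y (fdd_coord V y)"
proof -
  have "\<exists>!v. is_expansion V y v" using assms by (simp add: fdd_def)
  then show ?thesis unfolding fdd_coord_def by (rule theI')
qed

lemma fdd_coord_sums:
  assumes "fdd sF V"
  shows "fdd_coord V y sums y"
  using fdd_coord_expansion[OF assms] by (simp add: is_expansion_def)

text \<open>The summands are spans, so adding two expansions termwise gives an expansion of
  \<open>x + y\<close>, and expansions are unique.\<close>

lemma fdd_coord_add:
  assumes F: "normed_space_over sF" and V: "fdd sF V"
  shows "fdd_coord V (x + y) j = fdd_coord V x j + fdd_coord V y j"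
proof -
  interpret F: normed_space_over sF by fact
  have "u + w \<in> V i" if "u \<in> V i" "w \<in> V i" for i u w
  proof -
    obtain B where "V i = F.span B" using V unfolding fdd_def by blast
    then show ?thesis using that by (simp add: F.span_add)
  qed
  then have "is_expansion V (x + y) (\<lambda>j. fdd_coord V x j + fdd_coord V y j)"
    using fdd_coord_expansion[OF V] by (auto simp: is_expansion_def intro: sums_add)
  moreover have "\<exists>!v. is_expansion V (x + y) v" using V by (simp add: fdd_def)
  ultimately have "fdd_coord V (x + y) = (\<lambda>j. fdd_coord V x j + fdd_coord V y j)"
    unfolding fdd_coord_def by (intro the1_equality)
  then show ?thesis by simp
qed

lemma fdd_proj_add:
  assumes "normed_space_over sF" "fdd sF V"
  shows "fdd_proj V m (x + y) = fdd_proj V m x + fdd_proj V m y"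
  by (simp add: fdd_proj_def fdd_coord_add[OF assms] sum.distrib)

lemma fdd_coproj_add:
  assumes "normed_space_over sF" "fdd sF V"
  shows "fdd_coproj V m (x + y) = fdd_coproj V m x + fdd_coproj V m y"
  by (simp add: fdd_coproj_def fdd_proj_add[OF assms])

lemma fdd_coproj_tendsto_0:
  assumes "fdd sF V"
  shows "(\<lambda>m. fdd_coproj V m y) \<longlonglongrightarrow> 0"
proof -
  have "(\<lambda>m. y - fdd_proj V m y) \<longlonglongrightarrow> y - y"
    using fdd_coord_sums[OF assms, of y] unfolding sums_def fdd_proj_def
    by (intro tendsto_diff tendsto_const)
  then show ?thesis by (simp add: fdd_coproj_def)
qed

text \<open>The multipliers are \<open>c\<close> on the first \<open>m\<close> coordinates and 1 on
  the rest. The values \<open>c = 0\<close> and \<open>c = -1\<close> give the two contractions used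
  later.\<close>

lemma norm_fdd_coproj_add_scale_proj_le:
  assumes F: "normed_space_over sF" and V: "fdd sF V" "unconditional_constant_one sF V"
    and c: "norm c \<le> 1"
  shows "norm (fdd_coproj V m y + sF c (fdd_proj V m y)) \<le> norm y"
proof -
  interpret F: normed_space_over sF by fact
  define \<theta> where "\<theta> j = (if j < m then c else 1)" for j
  \<comment> \<open>The multiplied series differs from the expansion of \<open>y\<close> in finitely
    many terms, so its sum is known directly.\<close>
  have "(\<lambda>j. fdd_coord V y j + (if j < m then sF c (fdd_coord V y j) - fdd_coord V y j else 0))
      sums (y + (\<Sum>j<m. sF c (fdd_coord V y j) - fdd_coord V y j))"
    using sums_If_finite[of "\<lambda>j. j < m" "\<lambda>j. sF c (fdd_coord V y j) - fdd_coord V y j"]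
    by (intro sums_add fdd_coord_sums[OF V(1)]) (simp_all add: lessThan_def)
  also have "(\<lambda>j. fdd_coord V y j + (if j < m then sF c (fdd_coord V y j) - fdd_coord V y j else 0))
      = (\<lambda>j. sF (\<theta> j) (fdd_coord V y j))"
    by (auto simp: \<theta>_def)
  also have "y + (\<Sum>j<m. sF c (fdd_coord V y j) - fdd_coord V y j)
      = fdd_coproj V m y + sF c (fdd_proj V m y)"
    by (simp add: fdd_coproj_def fdd_proj_def sum_subtractf F.scale_sum_right)
  finally have "fdd_coproj V m y + sF c (fdd_proj V m y) = (\<Sum>j. sF (\<theta> j) (fdd_coord V y j))"
    by (rule sums_unique)
  then show ?thesis
    using V(2) c unfolding unconditional_constant_one_def by (auto simp: \<theta>_def)
qed

lemma norm_fdd_coproj_le: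
  assumes "normed_space_over sF" "fdd sF V" "unconditional_constant_one sF V"
  shows "norm (fdd_coproj V m y) \<le> norm y"
proof -
  interpret F: normed_space_over sF by fact
  show ?thesis using norm_fdd_coproj_add_scale_proj_le[OF assms, of 0 m y] by simp
qed

lemma norm_fdd_coproj_minus_proj_le:
  assumes "normed_space_over sF" "fdd sF V" "unconditional_constant_one sF V"
  shows "norm (fdd_coproj V m y - fdd_proj V m y) \<le> norm y"
proof -
  interpret F: normed_space_over sF by fact
  show ?thesis using norm_fdd_coproj_add_scale_proj_le[OF assms, of "-1" m y] by simp
qed

section \<open>Failure of the 2-ball property\<close>

lemma poly_norm_uminus: "poly_norm (- f) = poly_norm f"
  by (simp add: poly_norm_def fun_Compl_def)

theorem proposition3p1:
  fixes sE :: "'k::{real_normed_field,heine_borel} \<Rightarrow> 'a::banach \<Rightarrow> 'a"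
    and sF :: "'k \<Rightarrow> 'b::banach \<Rightarrow> 'b"
    and V :: "nat \<Rightarrow> 'b set"
    and P Q :: "'a \<Rightarrow> 'b"
    and n m0 :: nat
    and \<delta> :: real
  assumes "normed_space_over sE" and "normed_space_over sF"
    and "unconditional_fdd sF V" and "unconditional_constant_one sF V"
    and "n \<ge> 1"
    and "P \<in> hom_poly sE sF n" and "Q \<in> hom_poly_w sE sF n"
    and "\<delta> > 0"
    and "0 < poly_norm Q" and "poly_norm Q \<le> poly_norm P" and "poly_norm P < \<delta>"
    and "\<And>m. m \<ge> m0 \<Longrightarrow> poly_norm (\<lambda>x. fdd_coproj V m (P x) + Q x) \<ge> \<delta>"
  shows "\<not> semi_M_ideal (fun_scale sF) poly_norm (hom_poly sE sF n) (hom_poly_w sE sF n)"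
proof
  note EF = assms(1,2)
  note mod = fun_scale_module[OF EF(2)]
  let ?X = "hom_poly sE sF n" and ?J = "hom_poly_w sE sF n"
  have V: "fdd sF V" using assms(3) by (simp add: unconditional_fdd_def)
  have X: "module.subspace (fun_scale sF) ?X" by (rule hom_poly_subspace[OF EF])
  have J: "?J \<subseteq> ?X" "module.subspace (fun_scale sF) ?J"
    using hom_poly_w_closed_subspace[OF EF, of n] by (auto simp: closed_subspace_in_def)
  have PQ: "P \<in> ?X" "Q \<in> ?X" "P + Q \<in> ?X" "P - Q \<in> ?X" "- Q \<in> ?J"
    using assms(6,7) J module.subspace_add[OF mod X] module.subspace_diff[OF mod X]
      module.subspace_neg[OF mod J(2)] by auto
  assume "semi_M_ideal (fun_scale sF) poly_norm ?X ?J"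
  then have two: "two_ball_property poly_norm ?X ?J" by (simp add: semi_M_ideal_def)
  let ?r = "poly_norm P"
  \<comment> \<open>A third of the gap: one \<epsilon> is spent on enlarging the balls, one on the
    uniform tail, and the last keeps the final inequality strict after passing to the
    supremum.\<close>
  define \<epsilon> where "\<epsilon> = (\<delta> - ?r) / 3"
  have "\<epsilon> > 0" "?r > 0" using assms(9-11) by (auto simp: \<epsilon>_def)
  have "P \<in> ball_in poly_norm ?X (P + Q) ?r \<inter> ball_in poly_norm ?X (P - Q) ?r"
    using PQ assms(10) poly_norm_uminus[of Q] by (simp add: ball_in_def)
  moreover have "Q \<in> ball_in poly_norm ?X (P + Q) ?r \<inter> ?J"
    using PQ assms(7) poly_norm_uminus[of P] by (simp add: ball_in_def)
  moreover have "- Q \<in> ball_in poly_norm ?X (P - Q) ?r \<inter> ?J"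
    using PQ J(1) poly_norm_uminus[of P] by (auto simp: ball_in_def)
  ultimately have "ball_in poly_norm ?X (P + Q) (?r + \<epsilon>) \<inter> ball_in poly_norm ?X (P - Q) (?r + \<epsilon>) \<inter> ?J \<noteq> {}"
    using two[unfolded two_ball_property_def, rule_format, OF PQ(3,4) \<open>?r > 0\<close> \<open>?r > 0\<close> _ \<open>\<epsilon> > 0\<close>]
    by blast
  then obtain R where R: "R \<in> ?J" "poly_norm (R - (P + Q)) \<le> ?r + \<epsilon>"
      "poly_norm (R - (P - Q)) \<le> ?r + \<epsilon>"
    unfolding ball_in_def by blast
  have QR: "Q + R \<in> ?J" using module.subspace_add[OF mod J(2)] assms(7) R(1) by blast
  have "uniform_limit (cball 0 1) (\<lambda>m x. fdd_coproj V m ((Q + R) x)) (\<lambda>_. 0) sequentially"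
    using QR hom_poly_diff_degree[OF EF, of "Q + R" n]
    by (intro uniform_limit_weakly_continuous_polynomial[OF EF(1), where k = "Suc n"]
        fdd_coproj_add[OF EF(2) V] norm_fdd_coproj_le[OF EF(2) V assms(4)] fdd_coproj_tendsto_0[OF V])
      (auto simp: hom_poly_w_def simp del: diff_degree_less.simps plus_fun_apply)
  then have "\<forall>\<^sub>F m in sequentially. \<forall>x\<in>cball 0 1. dist (fdd_coproj V m ((Q + R) x)) 0 < \<epsilon>"
    using \<open>\<epsilon> > 0\<close> by (rule uniform_limitD)
  with eventually_ge_at_top[of m0] obtain m where m: "m \<ge> m0"
    "\<forall>x\<in>cball 0 1. dist (fdd_coproj V m ((Q + R) x)) 0 < \<epsilon>"
    using eventually_happens'[OF sequentially_bot eventually_conj] by blast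
  have "norm (fdd_coproj V m (P x) + Q x) \<le> ?r + 2 * \<epsilon>" if x: "x \<in> cball 0 1" for x
  proof -
    define a where "a = P x + Q x - R x"
    define b where "b = P x - Q x - R x"
    have bound: "norm (S x) \<le> poly_norm S" if "S \<in> ?X" for S
      using norm_le_poly_norm[OF EF that, of x 1] x by simp
    have "R - (P + Q) \<in> ?X" "R - (P - Q) \<in> ?X"
      using module.subspace_diff[OF mod X] R(1) J(1) PQ by blast+
    from this[THEN bound] R(2,3) have ab: "norm a \<le> ?r + \<epsilon>" "norm b \<le> ?r + \<epsilon>"
      using norm_minus_commute[of "R x" "P x + Q x"] norm_minus_commute[of "R x" "P x - Q x"]
      by (auto simp: a_def b_def)
    have "P x = b + (Q + R) x" "a = b + (Q x + Q x)" by (simp_all add: a_def b_def)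
    \<comment> \<open>Since \<open>b\<close> is the sum of its two projections, adding their
      difference to \<open>b\<close> doubles the coprojection.\<close>
    moreover have "a + (fdd_coproj V m b - fdd_proj V m b) = 2 *\<^sub>R (fdd_coproj V m b + Q x)"
      unfolding \<open>a = b + (Q x + Q x)\<close> by (simp add: fdd_coproj_def scaleR_2)
    ultimately have "fdd_coproj V m (P x) + Q x
        = (1/2) *\<^sub>R (a + (fdd_coproj V m b - fdd_proj V m b)) + fdd_coproj V m ((Q + R) x)"
      by (simp add: fdd_coproj_add[OF EF(2) V] add_ac)
    also have "norm \<dots> \<le> (1/2) * (norm a + norm b) + \<epsilon>"
    proof (rule norm_triangle_mono)
      show "norm ((1/2) *\<^sub>R (a + (fdd_coproj V m b - fdd_proj V m b))) \<le> (1/2) * (norm a + norm b)"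
        using norm_triangle_mono[OF order_refl norm_fdd_coproj_minus_proj_le[OF EF(2) V assms(4)]]
        by simp
      show "norm (fdd_coproj V m ((Q + R) x)) \<le> \<epsilon>" using bspec[OF m(2) x] by simp
    qed
    also have "\<dots> \<le> ?r + 2 * \<epsilon>" using ab by simp
    finally show ?thesis .
  qed
  then have "poly_norm (\<lambda>x. fdd_coproj V m (P x) + Q x) \<le> ?r + 2 * \<epsilon>"
    unfolding poly_norm_def by (intro cSUP_least) auto
  also have "\<dots> < \<delta>" using assms(11) by (simp add: \<epsilon>_def field_simps)
  finally show False using assms(12)[OF m(1)] by simp
qed

end
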